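(* Let $(L,\cdot,[,],\alpha,\beta)$ be a regular strong BiHom-Poisson algebra over $K$. Define a ternary operation on $L$ by $$[x,y,z]=x\cdot[\beta^{-1}(y),\beta^{-1}(z)]+y\cdot[\alpha^{-1}(z),\alpha\beta^{-2}(x)]+\alpha^{-1}\beta(z)\cdot[\beta^{-1}(x),\alpha\beta^{-2}(y)],\quad x,y,z\in L.$$ Then $(L,[\ ,\ ,\ ],\alpha,\beta)$ is a 3-BiHom-Lie algebra, and for all $x,y,z,u,v,w\in L$ $$0=[\beta^2(x),\beta^2(y),\alpha\beta(u)]\cdot[\alpha\beta(z),\alpha\beta(v),\alpha^2(w)]-[\beta^2(x),\beta^2(y),\alpha\beta(z)]\cdot[\alpha\beta(u),\alpha\beta(v),\alpha^2(w)]$$ $$+[\beta^2(x),\beta^2(y),\alpha\beta(w)]\cdot[\alpha\beta(z),\alpha\beta(u),\alpha^2(v)]-[\beta^2(x),\beta^2(y),\alpha\beta(v)]\cdot[\alpha\beta(z),\alpha\beta(u),\alpha^2(w)].$$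
   Context: $K$ is a field of characteristic $0$; all vector spaces and linear maps are over $K$. A BiHom-commutative algebra $(L,\cdot,\alpha,\beta)$ is a vector space $L$ with a bilinear product $\cdot$ and linear maps $\alpha,\beta:L\to L$ such that for all $x,y,z$: $\alpha\circ\beta=\beta\circ\alpha$, $\alpha(x\cdot y)=\alpha(x)\cdot\alpha(y)$, $\beta(x\cdot y)=\beta(x)\cdot\beta(y)$, $\alpha(x)\cdot(y\cdot z)=(x\cdot y)\cdot\beta(z)$, and $\beta(x)\cdot\alpha(y)=\beta(y)\cdot\alpha(x)$. A BiHom-Lie algebra $(L,[,],\alpha,\beta)$ is a vector space $L$ with a bilinear bracket and commuting linear maps $\alpha,\beta:L\to L$ such that for all $x,y,z$: $\alpha([x,y])=[\alpha(x),\alpha(y)]$, $\beta([x,y])=[\beta(x),\beta(y)]$, $[\beta(x),\alpha(y)]=-[\beta(y),\alpha(x)]$, and $[[\beta(x),\alpha(y)],\alpha^2(z)]+[[\beta(y),\alpha(z)],\alpha^2(x)]+[[\beta(z),\alpha(x)],\alpha^2(y)]=0$. A BiHom-Poisson algebra is a 5-tuple $(L,\cdot,[,],\alpha,\beta)$ such that $(L,\cdot,\alpha,\beta)$ is a BiHom-commutative algebra, $(L,[,],\alpha,\beta)$ is a BiHom-Lie algebra, and for all $x,y,z$: $[\alpha\beta(x),y\cdot z]=[\beta(x),y]\cdot\beta(z)+\beta(y)\cdot[\alpha(x),z]$. It is regular if $\alpha,\beta$ are invertible, and strong if for all $x,y,z,h\in L$ the sum over cyclic permutations of $x,y,z$ of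 $[\alpha\beta^{3}(x),\alpha^{2}\beta^{2}(y)]\cdot[\alpha^{2}\beta(h),\alpha^{3}\beta(z)]$ is $0$. A 3-BiHom-Lie algebra $(L,[\ ,\ ,\ ],\alpha,\beta)$ is a vector space $L$ with commuting linear maps $\alpha,\beta:L\to L$ and a trilinear map $[\ ,\ ,\ ]$ such that for all $x,y,z,u,v\in L$: (i) $\alpha([x,y,z])=[\alpha(x),\alpha(y),\alpha(z)]$ and $\beta([x,y,z])=[\beta(x),\beta(y),\beta(z)]$; (ii) $[\beta(x),\beta(y),\alpha(z)]=-[\beta(y),\beta(x),\alpha(z)]=-[\beta(x),\beta(z),\alpha(y)]$; (iii) $[\beta^2(u),\beta^2(v),[\beta(x),\beta(y),\alpha(z)]]=[\beta^2(y),\beta^2(z),[\beta(u),\beta(v),\alpha(x)]]-[\beta^2(x),\beta^2(z),[\beta(u),\beta(v),\alpha(y)]]+[\beta^2(x),\beta^2(y),[\beta(u),\beta(v),\alpha(z)]]$. *)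

theory Defs
  imports Complex_Main
begin

definition bilinear_map ::
  "('k::field \<Rightarrow> 'a::ab_group_add \<Rightarrow> 'a) \<Rightarrow> ('a \<Rightarrow> 'a \<Rightarrow> 'a) \<Rightarrow> bool" where
  "bilinear_map scale f \<longleftrightarrow>
     (\<forall>x. Vector_Spaces.linear scale scale (\<lambda>y. f x y)) \<and>
     (\<forall>y. Vector_Spaces.linear scale scale (\<lambda>x. f x y))"

definition trilinear_map ::
  "('k::field \<Rightarrow> 'a::ab_group_add \<Rightarrow> 'a) \<Rightarrow> ('a \<Rightarrow> 'a \<Rightarrow> 'a \<Rightarrow> 'a) \<Rightarrow> bool" where
  "trilinear_map scale f \<longleftrightarrow>
     (\<forall>y z. Vector_Spaces.linear scale scale (\<lambda>x. f x y z)) \<and>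
     (\<forall>x z. Vector_Spaces.linear scale scale (\<lambda>y. f x y z)) \<and>
     (\<forall>x y. Vector_Spaces.linear scale scale (\<lambda>z. f x y z))"

text \<open>The underlying vector space is the whole type \<open>'a\<close>, with scalar multiplication \<open>scale\<close>.\<close>

locale bihom_space = vector_space scale
  for scale :: "'k::field_char_0 \<Rightarrow> 'a::ab_group_add \<Rightarrow> 'a" +
  fixes \<alpha> \<beta> :: "'a \<Rightarrow> 'a"
  assumes linear_alpha: "Vector_Spaces.linear scale scale \<alpha>"
    and linear_beta: "Vector_Spaces.linear scale scale \<beta>"
    and alpha_beta_commute: "\<alpha> \<circ> \<beta> = \<beta> \<circ> \<alpha>"

locale bihom_commutative_algebra = bihom_space scale \<alpha> \<beta>
  for scale :: "'k::field_char_0 \<Rightarrow> 'a::ab_group_add \<Rightarrow> 'a"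
    and mul :: "'a \<Rightarrow> 'a \<Rightarrow> 'a" (infixl \<open>\<bullet>\<close> 70)
    and \<alpha> \<beta> :: "'a \<Rightarrow> 'a" +
  assumes bilinear_mul: "bilinear_map scale (\<bullet>)"
    and alpha_mul: "\<alpha> (x \<bullet> y) = \<alpha> x \<bullet> \<alpha> y"
    and beta_mul: "\<beta> (x \<bullet> y) = \<beta> x \<bullet> \<beta> y"
    and bihom_assoc: "\<alpha> x \<bullet> (y \<bullet> z) = (x \<bullet> y) \<bullet> \<beta> z"
    and bihom_commute: "\<beta> x \<bullet> \<alpha> y = \<beta> y \<bullet> \<alpha> x"

locale bihom_lie_algebra = bihom_space scale \<alpha> \<beta>
  for scale :: "'k::field_char_0 \<Rightarrow> 'a::ab_group_add \<Rightarrow> 'a"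
    and br :: "'a \<Rightarrow> 'a \<Rightarrow> 'a" (\<open>\<lbrakk>_,/ _\<rbrakk>\<close>)
    and \<alpha> \<beta> :: "'a \<Rightarrow> 'a" +
  assumes bilinear_br: "bilinear_map scale br"
    and alpha_br: "\<alpha> \<lbrakk>x, y\<rbrakk> = \<lbrakk>\<alpha> x, \<alpha> y\<rbrakk>"
    and beta_br: "\<beta> \<lbrakk>x, y\<rbrakk> = \<lbrakk>\<beta> x, \<beta> y\<rbrakk>"
    and bihom_skew: "\<lbrakk>\<beta> x, \<alpha> y\<rbrakk> = - \<lbrakk>\<beta> y, \<alpha> x\<rbrakk>"
    and bihom_jacobi:
      "\<lbrakk>\<lbrakk>\<beta> x, \<alpha> y\<rbrakk>, (\<alpha> ^^ 2) z\<rbrakk> + \<lbrakk>\<lbrakk>\<beta> y, \<alpha> z\<rbrakk>, (\<alpha> ^^ 2) x\<rbrakk> + \<lbrakk>\<lbrakk>\<beta> z, \<alpha> x\<rbrakk>, (\<alpha> ^^ 2) y\<rbrakk> = 0"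

locale bihom_poisson_algebra =
  bihom_commutative_algebra scale mul \<alpha> \<beta> + bihom_lie_algebra scale br \<alpha> \<beta>
  for scale :: "'k::field_char_0 \<Rightarrow> 'a::ab_group_add \<Rightarrow> 'a"
    and mul :: "'a \<Rightarrow> 'a \<Rightarrow> 'a" (infixl \<open>\<bullet>\<close> 70)
    and br :: "'a \<Rightarrow> 'a \<Rightarrow> 'a" (\<open>\<lbrakk>_,/ _\<rbrakk>\<close>)
    and \<alpha> \<beta> :: "'a \<Rightarrow> 'a" +
  assumes bihom_leibniz: "\<lbrakk>\<alpha> (\<beta> x), y \<bullet> z\<rbrakk> = \<lbrakk>\<beta> x, y\<rbrakk> \<bullet> \<beta> z + \<beta> y \<bullet> \<lbrakk>\<alpha> x, z\<rbrakk>"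

locale regular_bihom_poisson_algebra = bihom_poisson_algebra +
  assumes bij_alpha: "bij \<alpha>" and bij_beta: "bij \<beta>"

locale strong_bihom_poisson_algebra = bihom_poisson_algebra +
  assumes strong:
    "\<lbrakk>\<alpha> ((\<beta> ^^ 3) x), (\<alpha> ^^ 2) ((\<beta> ^^ 2) y)\<rbrakk> \<bullet> \<lbrakk>(\<alpha> ^^ 2) (\<beta> h), (\<alpha> ^^ 3) (\<beta> z)\<rbrakk>
     + \<lbrakk>\<alpha> ((\<beta> ^^ 3) y), (\<alpha> ^^ 2) ((\<beta> ^^ 2) z)\<rbrakk> \<bullet> \<lbrakk>(\<alpha> ^^ 2) (\<beta> h), (\<alpha> ^^ 3) (\<beta> x)\<rbrakk>
     + \<lbrakk>\<alpha> ((\<beta> ^^ 3) z), (\<alpha> ^^ 2) ((\<beta> ^^ 2) x)\<rbrakk> \<bullet> \<lbrakk>(\<alpha> ^^ 2) (\<beta> h), (\<alpha> ^^ 3) (\<beta> y)\<rbrakk> = 0"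

locale three_bihom_lie_algebra = bihom_space scale \<alpha> \<beta>
  for scale :: "'k::field_char_0 \<Rightarrow> 'a::ab_group_add \<Rightarrow> 'a"
    and tbr :: "'a \<Rightarrow> 'a \<Rightarrow> 'a \<Rightarrow> 'a" (\<open>\<lbrakk>_,/ _,/ _\<rbrakk>\<close>)
    and \<alpha> \<beta> :: "'a \<Rightarrow> 'a" +
  assumes trilinear_tbr: "trilinear_map scale tbr"
    and alpha_tbr: "\<alpha> \<lbrakk>x, y, z\<rbrakk> = \<lbrakk>\<alpha> x, \<alpha> y, \<alpha> z\<rbrakk>"
    and beta_tbr: "\<beta> \<lbrakk>x, y, z\<rbrakk> = \<lbrakk>\<beta> x, \<beta> y, \<beta> z\<rbrakk>"
    and bihom_skew_12: "\<lbrakk>\<beta> x, \<beta> y, \<alpha> z\<rbrakk> = - \<lbrakk>\<beta> y, \<beta> x, \<alpha> z\<rbrakk>"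
    and bihom_skew_23: "\<lbrakk>\<beta> x, \<beta> y, \<alpha> z\<rbrakk> = - \<lbrakk>\<beta> x, \<beta> z, \<alpha> y\<rbrakk>"
    and three_bihom_jacobi:
      "\<lbrakk>(\<beta> ^^ 2) u, (\<beta> ^^ 2) v, \<lbrakk>\<beta> x, \<beta> y, \<alpha> z\<rbrakk>\<rbrakk> =
         \<lbrakk>(\<beta> ^^ 2) y, (\<beta> ^^ 2) z, \<lbrakk>\<beta> u, \<beta> v, \<alpha> x\<rbrakk>\<rbrakk>
         - \<lbrakk>(\<beta> ^^ 2) x, (\<beta> ^^ 2) z, \<lbrakk>\<beta> u, \<beta> v, \<alpha> y\<rbrakk>\<rbrakk>
         + \<lbrakk>(\<beta> ^^ 2) x, (\<beta> ^^ 2) y, \<lbrakk>\<beta> u, \<beta> v, \<alpha> z\<rbrakk>\<rbrakk>"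

definition poisson_ternary ::
  "('a::ab_group_add \<Rightarrow> 'a \<Rightarrow> 'a) \<Rightarrow> ('a \<Rightarrow> 'a \<Rightarrow> 'a) \<Rightarrow> ('a \<Rightarrow> 'a) \<Rightarrow> ('a \<Rightarrow> 'a)
    \<Rightarrow> 'a \<Rightarrow> 'a \<Rightarrow> 'a \<Rightarrow> 'a" where
  "poisson_ternary mul br \<alpha> \<beta> x y z =
     mul x (br (inv \<beta> y) (inv \<beta> z))
     + mul y (br (inv \<alpha> z) (\<alpha> ((inv \<beta> ^^ 2) x)))
     + mul (inv \<alpha> (\<beta> z)) (br (inv \<beta> x) (\<alpha> ((inv \<beta> ^^ 2) y)))"

end

theory Submission
  imports Defs
begin

text \<open>
  The twisting maps can be removed.  Because \<open>\<alpha>\<close> and \<open>\<beta>\<close> are bijective, both products are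
  \<^emph>\<open>Yau twists\<close>: with \<open>x \<star> y = \<alpha>\<inverse>x \<bullet> \<beta>\<inverse>y\<close> and \<open>{x, y} = [\<alpha>\<inverse>x, \<beta>\<inverse>y]\<close> one has
  \<open>x \<bullet> y = \<alpha>x \<star> \<beta>y\<close> and \<open>[x, y] = {\<alpha>x, \<beta>y}\<close>.  In each BiHom axiom the powers of \<open>\<alpha>\<close> and
  \<open>\<beta>\<close> are placed so that, rewritten in this way, every variable occurs under one fixed
  automorphism; surjectivity then strips these automorphisms and leaves the axioms of an
  ordinary commutative Poisson algebra, of which \<open>\<alpha>\<close> and \<open>\<beta>\<close> are commuting automorphisms
  (\<open>poisson_untwist\<close>).  Likewise the strong condition becomes
  \<open>{x, y} \<star> {h, z} + {y, z} \<star> {h, x} + {z, x} \<star> {h, y} = 0\<close>, and the ternary operation becomes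
  \<open>[x, y, z] = T(\<alpha>x, \<alpha>y, \<beta>z)\<close> with
  \<open>T(x, y, z) = x \<star> {y, z} + y \<star> {z, x} + z \<star> {x, y}\<close> (\<open>poisson_ternary_untwist\<close>).

  It remains to treat a strong Poisson algebra without twists.  The map \<open>w \<mapsto> T(u, v, w)\<close> is a
  first-order operator \<open>X + c\<close>, where \<open>X = u \<star> {v, -} - v \<star> {u, -}\<close> is a derivation of \<open>\<star>\<close> and
  \<open>c = {u, v}\<close> acts by multiplication.  The field \<open>X\<close> is not a derivation of the bracket, but
  by the strong condition its failure is \<open>X{x, y} - {Xx, y} - {x, Xy} = 2c \<star> {x, y}\<close>
  (\<open>vf_pb\<close>).  Hence \<open>X\<close> moves through \<open>T\<close> with defect \<open>2c \<star> T\<close>, so \<open>X + c\<close> acts on the value of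
  \<open>T\<close> with total defect \<open>3c \<star> T\<close>, and this is what multiplication by \<open>c\<close> in the three arguments
  contributes (\<open>ternary_mult_arguments\<close>).  This proves the fundamental identity
  (\<open>ternary_fundamental\<close>).  The quadratic identity (\<open>ternary_plucker\<close>) is the Pluecker relation
  for \<open>T\<close>; its coefficients are Pluecker relations for the bracket, that is, again instances of
  the strong condition.
\<close>

section \<open>Strong Poisson algebras\<close>

lemma bilinear_map_expand:
  assumes "bilinear_map scale f"
  shows "f (x + y) z = f x z + f y z" "f z (x + y) = f z x + f z y"
    "f (- x) z = - f x z" "f z (- x) = - f z x"
    "f (x - y) z = f x z - f y z" "f z (x - y) = f z x - f z y"
    "f (scale r x) z = scale r (f x z)" "f z (scale r x) = scale r (f z x)"
proof -
  have L: "Vector_Spaces.linear scale scale (\<lambda>x. f x z)" "Vector_Spaces.linear scale scale (f z)"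
    using assms unfolding bilinear_map_def by auto
  interpret l: Vector_Spaces.linear scale scale "\<lambda>x. f x z" by (rule L)
  interpret r: Vector_Spaces.linear scale scale "f z" by (rule L)
  show "f (x + y) z = f x z + f y z" "f z (x + y) = f z x + f z y"
    "f (- x) z = - f x z" "f z (- x) = - f z x"
    "f (x - y) z = f x z - f y z" "f z (x - y) = f z x - f z y"
    "f (scale r x) z = scale r (f x z)" "f z (scale r x) = scale r (f z x)"
    by (simp_all add: l.add r.add l.neg r.neg l.diff r.diff l.scale r.scale)
qed

locale poisson_algebra = vector_space scale
  for scale :: "'k::field \<Rightarrow> 'a::ab_group_add \<Rightarrow> 'a" +
  fixes mul :: "'a \<Rightarrow> 'a \<Rightarrow> 'a" (infixl \<open>\<star>\<close> 70)
    and pb :: "'a \<Rightarrow> 'a \<Rightarrow> 'a" (\<open>\<lbrace>_,/ _\<rbrace>\<close>)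
  assumes bilinear_mul: "bilinear_map scale (\<star>)"
    and assoc: "(x \<star> y) \<star> z = x \<star> (y \<star> z)"
    and commute: "x \<star> y = y \<star> x"
    and bilinear_pb: "bilinear_map scale pb"
    and skew: "\<lbrace>x, y\<rbrace> = - \<lbrace>y, x\<rbrace>"
    and jacobi: "\<lbrace>\<lbrace>x, y\<rbrace>, z\<rbrace> + \<lbrace>\<lbrace>y, z\<rbrace>, x\<rbrace> + \<lbrace>\<lbrace>z, x\<rbrace>, y\<rbrace> = 0"
    and leibniz: "\<lbrace>x, y \<star> z\<rbrace> = \<lbrace>x, y\<rbrace> \<star> z + y \<star> \<lbrace>x, z\<rbrace>"
begin

lemmas mul_expand = bilinear_map_expand[OF bilinear_mul]
lemmas pb_expand = bilinear_map_expand[OF bilinear_pb]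

lemma left_commute: "x \<star> (y \<star> z) = y \<star> (x \<star> z)"
  by (metis assoc commute)

lemmas mul_ac = assoc commute left_commute

lemma leibniz_left: "\<lbrace>y \<star> z, x\<rbrace> = \<lbrace>y, x\<rbrace> \<star> z + y \<star> \<lbrace>z, x\<rbrace>"
  using leibniz[of x y z] by (simp add: skew[of _ x] mul_expand)

lemma pb_derivation: "\<lbrace>v, \<lbrace>x, y\<rbrace>\<rbrace> = \<lbrace>\<lbrace>v, x\<rbrace>, y\<rbrace> + \<lbrace>x, \<lbrace>v, y\<rbrace>\<rbrace>"
proof -
  have "\<lbrace>v, \<lbrace>x, y\<rbrace>\<rbrace> = - \<lbrace>\<lbrace>x, y\<rbrace>, v\<rbrace>" by (rule skew)
  moreover have "\<lbrace>x, \<lbrace>v, y\<rbrace>\<rbrace> = \<lbrace>\<lbrace>y, v\<rbrace>, x\<rbrace>"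
    by (metis skew minus_minus pb_expand(3))
  ultimately show ?thesis
    using jacobi[of x y v] by (simp add: neg_eq_iff_add_eq_0 add_ac)
qed

definition ternary :: "'a \<Rightarrow> 'a \<Rightarrow> 'a \<Rightarrow> 'a" where
  "ternary x y z = x \<star> \<lbrace>y, z\<rbrace> + y \<star> \<lbrace>z, x\<rbrace> + z \<star> \<lbrace>x, y\<rbrace>"

lemma ternary_expand:
  "ternary (a + b) y z = ternary a y z + ternary b y z"
  "ternary y (a + b) z = ternary y a z + ternary y b z"
  "ternary y z (a + b) = ternary y z a + ternary y z b"
  "ternary (scale r a) y z = scale r (ternary a y z)"
  "ternary y (scale r a) z = scale r (ternary y a z)"
  "ternary y z (scale r a) = scale r (ternary y z a)"
  by (simp_all add: ternary_def mul_expand pb_expand scale_right_distrib algebra_simps)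

lemma ternary_skew_12: "ternary x y z = - ternary y x z"
  by (simp add: ternary_def skew[of x y] skew[of x z] skew[of z y] mul_expand)

lemma ternary_cyclic: "ternary x y z = ternary y z x"
  by (simp add: ternary_def algebra_simps)

lemma ternary_skew_23: "ternary x y z = - ternary x z y"
  by (metis ternary_cyclic ternary_skew_12)

text \<open>
  In terms of the Hamiltonian vector fields \<open>H\<^sub>f = \<lbrace>f, -\<rbrace>\<close> this is \<open>u \<star> H\<^sub>v - v \<star> H\<^sub>u\<close>, the part of
  the operator \<open>ternary u v\<close> that differentiates.
\<close>
definition vf :: "'a \<Rightarrow> 'a \<Rightarrow> 'a \<Rightarrow> 'a" where
  "vf u v w = u \<star> \<lbrace>v, w\<rbrace> - v \<star> \<lbrace>u, w\<rbrace>"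

lemma vf_add: "vf u v (x + y) = vf u v x + vf u v y"
  by (simp add: vf_def mul_expand pb_expand algebra_simps)

lemma vf_mul: "vf u v (x \<star> y) = vf u v x \<star> y + x \<star> vf u v y"
  by (simp add: vf_def leibniz mul_expand mul_ac algebra_simps)

lemma ternary_eq_vf: "ternary u v w = vf u v w + \<lbrace>u, v\<rbrace> \<star> w"
  by (simp add: ternary_def vf_def skew[of w u] mul_expand commute)

text \<open>
  Each \<open>ternary (c \<star> x) y z\<close> differs from \<open>c \<star> ternary x y z\<close> by the two terms in which the
  bracket differentiates \<open>c\<close>; over the three positions these cancel in pairs.
\<close>
lemma ternary_mult_arguments:
  "ternary (c \<star> x) y z + ternary x (c \<star> y) z + ternary x y (c \<star> z)
    = c \<star> ternary x y z + c \<star> ternary x y z + c \<star> ternary x y z"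
  by (simp add: ternary_def leibniz leibniz_left skew[of x c] skew[of y c] skew[of z c]
      mul_expand mul_ac algebra_simps)

end

text \<open>The strong condition is the three-term Pluecker relation for the bracket.\<close>
locale strong_poisson_algebra = poisson_algebra +
  assumes strong: "\<lbrace>x, y\<rbrace> \<star> \<lbrace>h, z\<rbrace> + \<lbrace>y, z\<rbrace> \<star> \<lbrace>h, x\<rbrace> + \<lbrace>z, x\<rbrace> \<star> \<lbrace>h, y\<rbrace> = 0"
begin

lemma pb_plucker: "\<lbrace>h, a\<rbrace> \<star> \<lbrace>b, c\<rbrace> = \<lbrace>h, b\<rbrace> \<star> \<lbrace>a, c\<rbrace> - \<lbrace>h, c\<rbrace> \<star> \<lbrace>a, b\<rbrace>"
  using strong[of a b h c] skew[of c a]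
  by (simp add: mul_expand commute eq_neg_iff_add_eq_0 algebra_simps)

text \<open>
  The bracket is a biderivation, so \<open>u \<star> \<lbrace>v, -\<rbrace>\<close> fails to be a derivation of it only through the
  terms in which \<open>u\<close> is differentiated.  They add up to twice
  \<open>\<lbrace>u, x\<rbrace> \<star> \<lbrace>v, y\<rbrace> - \<lbrace>v, x\<rbrace> \<star> \<lbrace>u, y\<rbrace>\<close>, which the Pluecker relation turns into a multiple of
  \<open>\<lbrace>x, y\<rbrace>\<close> itself.
\<close>
lemma vf_pb:
  "vf u v \<lbrace>x, y\<rbrace> = \<lbrace>vf u v x, y\<rbrace> + \<lbrace>x, vf u v y\<rbrace> + \<lbrace>u, v\<rbrace> \<star> \<lbrace>x, y\<rbrace> + \<lbrace>u, v\<rbrace> \<star> \<lbrace>x, y\<rbrace>"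
proof -
  have P: "\<lbrace>u, v\<rbrace> \<star> \<lbrace>x, y\<rbrace> = \<lbrace>u, x\<rbrace> \<star> \<lbrace>v, y\<rbrace> - \<lbrace>u, y\<rbrace> \<star> \<lbrace>v, x\<rbrace>"
    by (rule pb_plucker)
  show ?thesis
    unfolding P vf_def pb_derivation[of v x y] pb_derivation[of u x y]
    by (simp add: leibniz leibniz_left skew[of x u] skew[of x v] mul_expand pb_expand
        commute algebra_simps)
qed

lemma vf_ternary:
  "vf u v (ternary x y z)
    = ternary (vf u v x) y z + ternary x (vf u v y) z + ternary x y (vf u v z)
      + \<lbrace>u, v\<rbrace> \<star> ternary x y z + \<lbrace>u, v\<rbrace> \<star> ternary x y z"
  by (simp add: ternary_def vf_add vf_mul vf_pb mul_expand left_commute[of "\<lbrace>u, v\<rbrace>"]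
      algebra_simps)

lemma ternary_derivation:
  "ternary u v (ternary x y z)
    = ternary (ternary u v x) y z + ternary x (ternary u v y) z + ternary x y (ternary u v z)"
proof -
  let ?c = "\<lbrace>u, v\<rbrace>"
  have "ternary (ternary u v x) y z + ternary x (ternary u v y) z + ternary x y (ternary u v z)
    = (ternary (vf u v x) y z + ternary x (vf u v y) z + ternary x y (vf u v z))
      + (ternary (?c \<star> x) y z + ternary x (?c \<star> y) z + ternary x y (?c \<star> z))"
    by (simp add: ternary_eq_vf[of u v] ternary_expand algebra_simps)
  then show ?thesis
    unfolding ternary_mult_arguments
    by (simp add: ternary_eq_vf[of u v "ternary x y z"] vf_ternary algebra_simps)
qed

lemma ternary_fundamental:
  "ternary u v (ternary x y z)
    = ternary y z (ternary u v x) - ternary x z (ternary u v y) + ternary x y (ternary u v z)"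
  using ternary_derivation[of u v x y z] ternary_cyclic[of "ternary u v x" y z]
    ternary_skew_23[of x "ternary u v y" z]
  by simp

text \<open>
  Expanding the products gives two kinds of terms.  Those with the factor \<open>\<lbrace>x, y\<rbrace>\<close> cancel in
  pairs.  In the others \<open>x\<close> or \<open>y\<close> stands outside the brackets together with one of \<open>a, b, c, d\<close>,
  and the coefficient of each such product is a three-term Pluecker relation.
\<close>
lemma ternary_plucker:
  "ternary x y a \<star> ternary b c d - ternary x y b \<star> ternary a c d
    + ternary x y c \<star> ternary a b d - ternary x y d \<star> ternary a b c = 0"
proof -
  have T: "ternary p q r = p \<star> \<lbrace>q, r\<rbrace> - q \<star> \<lbrace>p, r\<rbrace> + r \<star> \<lbrace>p, q\<rbrace>" for p q r
    by (simp add: ternary_def skew[of r p] mul_expand)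
  have Q: "(p \<star> q) \<star> (r \<star> s) = (p \<star> r) \<star> (q \<star> s)" for p q r s
    by (simp add: mul_ac)
  \<comment> \<open>Among three arguments the pairing of \<open>h\<close> with the alphabetically first one is eliminated;
    the two pairings that remain serve as a normal form.\<close>
  have P: "\<lbrace>h, a\<rbrace> \<star> \<lbrace>b, c\<rbrace> = \<lbrace>h, b\<rbrace> \<star> \<lbrace>a, c\<rbrace> - \<lbrace>h, c\<rbrace> \<star> \<lbrace>a, b\<rbrace>"
    "\<lbrace>h, a\<rbrace> \<star> \<lbrace>b, d\<rbrace> = \<lbrace>h, b\<rbrace> \<star> \<lbrace>a, d\<rbrace> - \<lbrace>h, d\<rbrace> \<star> \<lbrace>a, b\<rbrace>"
    "\<lbrace>h, a\<rbrace> \<star> \<lbrace>c, d\<rbrace> = \<lbrace>h, c\<rbrace> \<star> \<lbrace>a, d\<rbrace> - \<lbrace>h, d\<rbrace> \<star> \<lbrace>a, c\<rbrace>"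
    "\<lbrace>h, b\<rbrace> \<star> \<lbrace>c, d\<rbrace> = \<lbrace>h, c\<rbrace> \<star> \<lbrace>b, d\<rbrace> - \<lbrace>h, d\<rbrace> \<star> \<lbrace>b, c\<rbrace>" for h
    by (rule pb_plucker)+
  have C: "b \<star> a = a \<star> b" "c \<star> a = a \<star> c" "d \<star> a = a \<star> d"
    "c \<star> b = b \<star> c" "d \<star> b = b \<star> d" "d \<star> c = c \<star> d"
    by (rule commute)+
  show ?thesis
    by (simp only: T mul_expand Q P[of x] P[of y] C) (simp add: algebra_simps)
qed

end

section \<open>Removing the twists\<close>

definition untwist :: "('a \<Rightarrow> 'a) \<Rightarrow> ('a \<Rightarrow> 'a) \<Rightarrow> ('a \<Rightarrow> 'a \<Rightarrow> 'a) \<Rightarrow> 'a \<Rightarrow> 'a \<Rightarrow> 'a" where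
  "untwist \<alpha> \<beta> f x y = f (inv \<alpha> x) (inv \<beta> y)"

lemma twist_untwist:
  assumes "bij \<alpha>" "bij \<beta>"
  shows "f x y = untwist \<alpha> \<beta> f (\<alpha> x) (\<beta> y)"
  using assms by (simp add: untwist_def bij_is_inj)

lemma untwist_multiplicative:
  assumes "bij \<alpha>" "bij \<beta>"
    and "\<And>x. \<gamma> (\<alpha> x) = \<alpha> (\<gamma> x)" "\<And>x. \<gamma> (\<beta> x) = \<beta> (\<gamma> x)"
    and "\<And>x y. \<gamma> (f x y) = f (\<gamma> x) (\<gamma> y)"
  shows "\<gamma> (untwist \<alpha> \<beta> f x y) = untwist \<alpha> \<beta> f (\<gamma> x) (\<gamma> y)"
proof -
  obtain x' y' where "x = \<alpha> x'" "y = \<beta> y'"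
    using assms(1,2) by (meson bij_pointE)
  then show ?thesis
    using assms by (simp add: twist_untwist[symmetric])
qed

lemma bilinear_map_untwist:
  assumes "bilinear_map scale f"
    and "Vector_Spaces.linear scale scale \<alpha>" "Vector_Spaces.linear scale scale \<beta>"
    and "bij \<alpha>" "bij \<beta>"
  shows "bilinear_map scale (untwist \<alpha> \<beta> f)"
proof -
  have inv: "Vector_Spaces.linear scale scale (inv g)"
    if "Vector_Spaces.linear scale scale g" "bij g" for g
  proof -
    interpret Vector_Spaces.linear scale scale g by (rule that)
    have inv_eq: "inv g x = y \<longleftrightarrow> x = g y" for x y
      using that(2) by (metis bij_inv_eq_iff)
    have "g (inv g x) = x" for x
      by (metis inv_eq)
    then have "inv g (x + y) = inv g x + inv g y" "inv g (scale r x) = scale r (inv g x)" for x y r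
      by (simp_all add: inv_eq add scale)
    then show ?thesis
      using that(1) by (simp add: Vector_Spaces.linear_iff)
  qed
  show ?thesis
    using assms(1) inv[OF assms(2,4)] inv[OF assms(3,5)]
    by (simp add: bilinear_map_def untwist_def Vector_Spaces.linear_iff)
qed

context regular_bihom_poisson_algebra
begin

abbreviation untwisted_mul :: "'b \<Rightarrow> 'b \<Rightarrow> 'b" (infixl \<open>\<star>\<close> 70) where
  "untwisted_mul \<equiv> untwist \<alpha> \<beta> (\<bullet>)"

abbreviation untwisted_br :: "'b \<Rightarrow> 'b \<Rightarrow> 'b" (\<open>\<lbrace>_,/ _\<rbrace>\<close>) where
  "untwisted_br \<equiv> untwist \<alpha> \<beta> br"

lemma alpha_beta: "\<beta> (\<alpha> x) = \<alpha> (\<beta> x)"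
  using alpha_beta_commute by (metis comp_apply)

lemmas mul_eq = twist_untwist[OF bij_alpha bij_beta, of "(\<bullet>)"]
lemmas br_eq = twist_untwist[OF bij_alpha bij_beta, of br]

lemma automorphism_untwist:
  "\<alpha> (x \<star> y) = \<alpha> x \<star> \<alpha> y" "\<beta> (x \<star> y) = \<beta> x \<star> \<beta> y"
  "\<alpha> \<lbrace>x, y\<rbrace> = \<lbrace>\<alpha> x, \<alpha> y\<rbrace>" "\<beta> \<lbrace>x, y\<rbrace> = \<lbrace>\<beta> x, \<beta> y\<rbrace>"
  using alpha_mul beta_mul alpha_br beta_br alpha_beta
  by (intro untwist_multiplicative[OF bij_alpha bij_beta]; simp)+

lemma surj_alpha_beta: "\<exists>x'. x = \<alpha> x'" "\<exists>x'. x = \<beta> x'"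
  using bij_alpha bij_beta by (metis bij_pointE)+

text \<open>
  Each axiom is obtained from its twisted form by writing the variables as images under those
  monomials in \<open>\<alpha>\<close> and \<open>\<beta>\<close> that the twisted form produces.
\<close>
lemma poisson_untwist: "poisson_algebra scale (\<star>) untwisted_br"
proof
  show "bilinear_map scale (\<star>)" "bilinear_map scale untwisted_br"
    using bilinear_map_untwist bilinear_mul bilinear_br linear_alpha linear_beta bij_alpha bij_beta
    by blast+
next
  fix x y z
  obtain x' where x: "x = \<alpha> (\<alpha> x')" by (metis surj_alpha_beta)
  obtain y' where y: "y = \<alpha> (\<beta> y')" by (metis surj_alpha_beta)
  obtain z' where z: "z = \<beta> (\<beta> z')" by (metis surj_alpha_beta)
  show "(x \<star> y) \<star> z = x \<star> (y \<star> z)"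
    using bihom_assoc[of x' y' z'] by (simp add: x y z mul_eq automorphism_untwist alpha_beta)
next
  fix x y
  obtain x' where x: "x = \<alpha> (\<beta> x')" by (metis surj_alpha_beta)
  obtain y' where y: "y = \<alpha> (\<beta> y')" by (metis surj_alpha_beta)
  show "x \<star> y = y \<star> x"
    using bihom_commute[of x' y'] by (simp add: x y mul_eq automorphism_untwist alpha_beta)
  show "\<lbrace>x, y\<rbrace> = - \<lbrace>y, x\<rbrace>"
    using bihom_skew[of x' y'] by (simp add: x y br_eq automorphism_untwist alpha_beta)
next
  fix x y z
  obtain x' where x: "x = \<alpha> (\<alpha> (\<beta> x'))" by (metis surj_alpha_beta)
  obtain y' where y: "y = \<alpha> (\<alpha> (\<beta> y'))" by (metis surj_alpha_beta)
  obtain z' where z: "z = \<alpha> (\<alpha> (\<beta> z'))" by (metis surj_alpha_beta)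
  show "\<lbrace>\<lbrace>x, y\<rbrace>, z\<rbrace> + \<lbrace>\<lbrace>y, z\<rbrace>, x\<rbrace> + \<lbrace>\<lbrace>z, x\<rbrace>, y\<rbrace> = 0"
    using bihom_jacobi[of x' y' z']
    by (simp add: x y z br_eq automorphism_untwist alpha_beta numeral_2_eq_2)
next
  fix x y z
  obtain x' where x: "x = \<alpha> (\<alpha> (\<beta> x'))" by (metis surj_alpha_beta)
  obtain y' where y: "y = \<alpha> (\<beta> y')" by (metis surj_alpha_beta)
  obtain z' where z: "z = \<beta> (\<beta> z')" by (metis surj_alpha_beta)
  show "\<lbrace>x, y \<star> z\<rbrace> = \<lbrace>x, y\<rbrace> \<star> z + y \<star> \<lbrace>x, z\<rbrace>"
    using bihom_leibniz[of x' y' z']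
    by (simp add: x y z mul_eq br_eq automorphism_untwist alpha_beta)
qed

end

locale regular_strong_bihom_poisson_algebra =
  regular_bihom_poisson_algebra + strong_bihom_poisson_algebra
begin

sublocale untwisted: strong_poisson_algebra scale untwisted_mul untwisted_br
proof -
  interpret poisson_algebra scale untwisted_mul untwisted_br
    by (rule poisson_untwist)
  show "strong_poisson_algebra scale untwisted_mul untwisted_br"
  proof
    fix x y z h
    obtain x' where x: "x = \<alpha> (\<alpha> (\<alpha> (\<beta> (\<beta> (\<beta> x')))))" by (metis surj_alpha_beta)
    obtain y' where y: "y = \<alpha> (\<alpha> (\<alpha> (\<beta> (\<beta> (\<beta> y')))))" by (metis surj_alpha_beta)
    obtain z' where z: "z = \<alpha> (\<alpha> (\<alpha> (\<beta> (\<beta> (\<beta> z')))))" by (metis surj_alpha_beta)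
    \<comment> \<open>In the twisted condition \<open>h\<close> carries one power of \<open>\<beta>\<close> less than \<open>x, y, z\<close>.\<close>
    obtain h' where h: "h = \<alpha> (\<alpha> (\<alpha> (\<beta> (\<beta> h'))))" by (metis surj_alpha_beta)
    show "\<lbrace>x, y\<rbrace> \<star> \<lbrace>h, z\<rbrace> + \<lbrace>y, z\<rbrace> \<star> \<lbrace>h, x\<rbrace> + \<lbrace>z, x\<rbrace> \<star> \<lbrace>h, y\<rbrace> = 0"
      using strong[of x' y' h' z']
      by (simp add: x y z h mul_eq br_eq automorphism_untwist alpha_beta
          numeral_2_eq_2 numeral_3_eq_3)
  qed
qed

abbreviation tbr :: "'b \<Rightarrow> 'b \<Rightarrow> 'b \<Rightarrow> 'b" where
  "tbr \<equiv> poisson_ternary (\<bullet>) br \<alpha> \<beta>"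

lemma poisson_ternary_untwist: "tbr x y z = untwisted.ternary (\<alpha> x) (\<alpha> y) (\<beta> z)"
proof -
  \<comment> \<open>These representations cancel every inverse in the definition of the ternary operation.\<close>
  obtain x' where x: "x = \<beta> (\<beta> x')" by (metis surj_alpha_beta)
  obtain y' where y: "y = \<beta> (\<beta> y')" by (metis surj_alpha_beta)
  obtain z' where z: "z = \<alpha> (\<beta> z')" by (metis surj_alpha_beta)
  have "inv \<alpha> (\<alpha> v) = v" "inv \<beta> (\<beta> v) = v" for v
    using bij_alpha bij_beta by (simp_all add: bij_is_inj)
  moreover from this have "inv \<beta> (\<alpha> (\<beta> v)) = \<alpha> v" "inv \<alpha> (\<beta> (\<alpha> v)) = \<beta> v" for v
    by (metis alpha_beta)+
  ultimately show ?thesis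
    by (simp add: poisson_ternary_def untwisted.ternary_def x y z mul_eq br_eq
        automorphism_untwist alpha_beta numeral_2_eq_2)
qed

lemma automorphism_ternary:
  "\<alpha> (untwisted.ternary x y z) = untwisted.ternary (\<alpha> x) (\<alpha> y) (\<alpha> z)"
  "\<beta> (untwisted.ternary x y z) = untwisted.ternary (\<beta> x) (\<beta> y) (\<beta> z)"
  using linear_alpha linear_beta
  by (simp_all add: untwisted.ternary_def automorphism_untwist Vector_Spaces.linear_iff)

lemmas tbr_simps =
  poisson_ternary_untwist mul_eq automorphism_ternary alpha_beta numeral_2_eq_2

lemma tbr_three_bihom_lie: "three_bihom_lie_algebra scale tbr \<alpha> \<beta>"
proof
  show "trilinear_map scale tbr"
    using linear_alpha linear_beta vector_space_axioms
    by (simp add: trilinear_map_def poisson_ternary_untwist Vector_Spaces.linear_iff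
        untwisted.ternary_expand)
next
  fix x y z
  show "\<alpha> (tbr x y z) = tbr (\<alpha> x) (\<alpha> y) (\<alpha> z)" "\<beta> (tbr x y z) = tbr (\<beta> x) (\<beta> y) (\<beta> z)"
    by (simp_all add: tbr_simps)
  show "tbr (\<beta> x) (\<beta> y) (\<alpha> z) = - tbr (\<beta> y) (\<beta> x) (\<alpha> z)"
    by (simp add: tbr_simps untwisted.ternary_skew_12[of "\<alpha> (\<beta> x)"])
  show "tbr (\<beta> x) (\<beta> y) (\<alpha> z) = - tbr (\<beta> x) (\<beta> z) (\<alpha> y)"
    by (simp add: tbr_simps untwisted.ternary_skew_23[of _ "\<alpha> (\<beta> y)"])
next
  fix u v x y z
  show "tbr ((\<beta> ^^ 2) u) ((\<beta> ^^ 2) v) (tbr (\<beta> x) (\<beta> y) (\<alpha> z))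
    = tbr ((\<beta> ^^ 2) y) ((\<beta> ^^ 2) z) (tbr (\<beta> u) (\<beta> v) (\<alpha> x))
      - tbr ((\<beta> ^^ 2) x) ((\<beta> ^^ 2) z) (tbr (\<beta> u) (\<beta> v) (\<alpha> y))
      + tbr ((\<beta> ^^ 2) x) ((\<beta> ^^ 2) y) (tbr (\<beta> u) (\<beta> v) (\<alpha> z))"
    by (simp add: tbr_simps) (rule untwisted.ternary_fundamental)
qed

text \<open>
  After untwisting, every variable stands under \<open>\<alpha>\<^sup>2\<beta>\<^sup>2\<close>, and the sum is the Pluecker relation for
  \<open>x, y\<close> and \<open>u, z, v, w\<close>, except that \<open>z\<close> precedes \<open>u\<close> in the last two products; this
  transposition explains their signs.
\<close>
lemma tbr_plucker:
  "tbr ((\<beta> ^^ 2) x) ((\<beta> ^^ 2) y) (\<alpha> (\<beta> u)) \<bullet> tbr (\<alpha> (\<beta> z)) (\<alpha> (\<beta> v)) ((\<alpha> ^^ 2) w)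
    - tbr ((\<beta> ^^ 2) x) ((\<beta> ^^ 2) y) (\<alpha> (\<beta> z)) \<bullet> tbr (\<alpha> (\<beta> u)) (\<alpha> (\<beta> v)) ((\<alpha> ^^ 2) w)
    + tbr ((\<beta> ^^ 2) x) ((\<beta> ^^ 2) y) (\<alpha> (\<beta> w)) \<bullet> tbr (\<alpha> (\<beta> z)) (\<alpha> (\<beta> u)) ((\<alpha> ^^ 2) v)
    - tbr ((\<beta> ^^ 2) x) ((\<beta> ^^ 2) y) (\<alpha> (\<beta> v)) \<bullet> tbr (\<alpha> (\<beta> z)) (\<alpha> (\<beta> u)) ((\<alpha> ^^ 2) w) = 0"
proof -
  let ?f = "\<lambda>x. \<alpha> (\<alpha> (\<beta> (\<beta> x)))"
  show ?thesis
    using untwisted.ternary_plucker[of "?f x" "?f y" "?f u" "?f z" "?f v" "?f w"]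
    by (simp add: tbr_simps untwisted.ternary_skew_12[of "?f z" "?f u"] untwisted.mul_expand
        algebra_simps)
qed

end

theorem proposition3p9:
  fixes scale :: "'k::field_char_0 \<Rightarrow> 'a::ab_group_add \<Rightarrow> 'a"
    and mul :: "'a \<Rightarrow> 'a \<Rightarrow> 'a" (infixl "\<bullet>" 70)
    and br :: "'a \<Rightarrow> 'a \<Rightarrow> 'a"
    and \<alpha> \<beta> :: "'a \<Rightarrow> 'a"
    and tbr :: "'a \<Rightarrow> 'a \<Rightarrow> 'a \<Rightarrow> 'a" ("\<lbrakk>_,/ _,/ _\<rbrakk>")
  defines "tbr \<equiv> poisson_ternary mul br \<alpha> \<beta>"
  assumes "regular_bihom_poisson_algebra scale mul br \<alpha> \<beta>"
    and "strong_bihom_poisson_algebra scale mul br \<alpha> \<beta>"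
  shows "three_bihom_lie_algebra scale tbr \<alpha> \<beta> \<and>
    (\<forall>x y z u v w.
      0 = \<lbrakk>(\<beta> ^^ 2) x, (\<beta> ^^ 2) y, \<alpha> (\<beta> u)\<rbrakk> \<bullet> \<lbrakk>\<alpha> (\<beta> z), \<alpha> (\<beta> v), (\<alpha> ^^ 2) w\<rbrakk>
        - \<lbrakk>(\<beta> ^^ 2) x, (\<beta> ^^ 2) y, \<alpha> (\<beta> z)\<rbrakk> \<bullet> \<lbrakk>\<alpha> (\<beta> u), \<alpha> (\<beta> v), (\<alpha> ^^ 2) w\<rbrakk>
        + \<lbrakk>(\<beta> ^^ 2) x, (\<beta> ^^ 2) y, \<alpha> (\<beta> w)\<rbrakk> \<bullet> \<lbrakk>\<alpha> (\<beta> z), \<alpha> (\<beta> u), (\<alpha> ^^ 2) v\<rbrakk>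
        - \<lbrakk>(\<beta> ^^ 2) x, (\<beta> ^^ 2) y, \<alpha> (\<beta> v)\<rbrakk> \<bullet> \<lbrakk>\<alpha> (\<beta> z), \<alpha> (\<beta> u), (\<alpha> ^^ 2) w\<rbrakk>)"
proof -
  interpret regular_strong_bihom_poisson_algebra scale mul br \<alpha> \<beta>
    using assms(2,3) by (rule regular_strong_bihom_poisson_algebra.intro)
  show ?thesis
    unfolding tbr_def using tbr_three_bihom_lie tbr_plucker by metis
qed

end
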